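(* Let $M=(S,s_{init},\mathit{Act},\mathit{Trans})$ be a finite LTS, $B\subseteq\mathit{Act}$ a set of blocking actions, $\rho$ a regular formula and $\alpha_f,\alpha_e\subseteq\mathit{Act}$. A state $s\in S$ satisfies the modal $\mu$-calculus formula $$\neg\langle\rho\rangle\,\nu X.\big(\langle\alpha_e\rangle\mathit{tt}\ \lor\ [\overline{B}]\mathit{ff}\ \lor\ \langle\overline{\alpha_f}\rangle X\big)$$ if, and only if, $s$ does not admit any path that is $B$-progressing and $(\rho,\alpha_f,\alpha_e)$-violating.
   Context: An LTS is $M=(S,s_{init},\mathit{Act},\mathit{Trans})$ with $\mathit{Trans}\subseteq S\times\mathit{Act}\times S$; here $S$ and $\mathit{Act}$ are finite. A path is an alternating sequence $s_0t_1s_1t_2\dots$ of states and transitions, starting with a state, either infinite or ending in a state (its final state), where each $t_{i+1}$ goes from $s_i$ to $s_{i+1}$. An action occurs on a path if some transition on it is labelled with that action; a path is $\alpha$-free if no action of $\alpha$ occurs on it. An action is enabled in $s$ if some transition labelled with it leaves $s$. For $\alpha\subseteq\mathit{Act}$, $\overline{\alpha}=\mathit{Act}\setminus\alpha$. A state is $B$-locked if all actions enabled in it are in $B$; a path is $B$-progressing if it is infinite or its final state is $B$-locked. Regular formulae: $R,Q::=\varepsilon\mid\alpha\mid R\cdot Q\mid R+Q\mid R^*$ with $\alpha\subseteq\mathit{Act}$; a finite path matches $R$ if its sequence of action labels is in the language of $R$ (where $\alpha$ denotes the one-letter words from $\alpha$). A path $\pi$ is $(\rho,\alpha_f,\alpha_e)$-violating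 if $\pi=\pi_{pre}\cdot\pi_{suf}$ (concatenation at a shared state) with $\pi_{pre}$ finite and matching $\rho$, and $\pi_{suf}$ either is $\alpha_f$-free, or contains an occurrence of an action in $\alpha_e$ and the prefix of $\pi_{suf}$ before the first such occurrence is $\alpha_f$-free. Modal $\mu$-calculus: $\phi::=\mathit{ff}\mid X\mid\neg\phi\mid\phi\lor\phi\mid\langle a\rangle\phi\mid\mu X.\phi$ (syntactically monotone) with standard semantics $[\![\cdot]\!]_e$ over environments $e$ mapping variables to sets of states ($\langle a\rangle\phi$ holds in $s$ iff some $a$-transition leads from $s$ to a state satisfying $\phi$; $\mu$ is the least fixpoint). Abbreviations: $\mathit{tt}=\neg\mathit{ff}$, $\land,\Rightarrow$ as usual, $[a]\phi=\neg\langle a\rangle\neg\phi$, $\nu X.\phi=\neg\mu X.\neg\phi[X:=\neg X]$ (greatest fixpoint); a single action $a$ also denotes $\{a\}$; $\langle\alpha\rangle\phi=\bigvee_{a\in\alpha}\langle a\rangle\phi$, $\langle\varepsilon\rangle\phi=\phi$, $\langle R\cdot Q\rangle\phi=\langle R\rangle\langle Q\rangle\phi$, $\langle R+Q\rangle\phi=\langle R\rangle\phi\lor\langle Q\rangle\phi$, $\langle R^*\rangle\phi=\mu Y.(\langle R\rangle Y\lor\phi)$ ($Y$ fresh), $[R]\phi=\neg\langle R\rangle\neg\phi$. *)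

theory Defs
  imports Main "HOL-Library.Stream"
begin

type_synonym ('s, 'a) trans = "'s \<times> 'a \<times> 's"

record ('s, 'a) lts =
  states :: "'s set"
  init :: 's
  acts :: "'a set"
  transs :: "('s, 'a) trans set"

definition finite_lts :: "('s, 'a) lts \<Rightarrow> bool" where
  "finite_lts M \<longleftrightarrow> finite (states M) \<and> finite (acts M) \<and> init M \<in> states M \<and>
     transs M \<subseteq> states M \<times> acts M \<times> states M"

fun src :: "('s, 'a) trans \<Rightarrow> 's" where "src (s, a, s') = s"
fun act :: "('s, 'a) trans \<Rightarrow> 'a" where "act (s, a, s') = a"
fun tgt :: "('s, 'a) trans \<Rightarrow> 's" where "tgt (s, a, s') = s'"

definition enabled :: "('s, 'a) lts \<Rightarrow> 's \<Rightarrow> 'a \<Rightarrow> bool" where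
  "enabled M s a \<longleftrightarrow> (\<exists>t \<in> transs M. src t = s \<and> act t = a)"

definition locked :: "('s, 'a) lts \<Rightarrow> 'a set \<Rightarrow> 's \<Rightarrow> bool" where
  "locked M B s \<longleftrightarrow> (\<forall>a. enabled M s a \<longrightarrow> a \<in> B)"

text \<open>A path is stored as its first state and its transitions; all later states of the
  alternating sequence are the targets of the transitions.\<close>

datatype ('s, 'a) path =
  FinPath 's "('s, 'a) trans list"
| InfPath 's "('s, 'a) trans stream"

primrec first :: "('s, 'a) path \<Rightarrow> 's" where
  "first (FinPath s ts) = s"
| "first (InfPath s us) = s"

primrec finite_path :: "('s, 'a) path \<Rightarrow> bool" where
  "finite_path (FinPath s ts) = True"
| "finite_path (InfPath s us) = False"

text \<open>Only meaningful for finite paths.\<close>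

fun final :: "('s, 'a) path \<Rightarrow> 's" where
  "final (FinPath s ts) = (if ts = [] then s else tgt (last ts))"
| "final (InfPath s us) = undefined"

text \<open>Only meaningful for finite paths.\<close>

fun word :: "('s, 'a) path \<Rightarrow> 'a list" where
  "word (FinPath s ts) = map act ts"
| "word (InfPath s us) = undefined"

primrec occurring :: "('s, 'a) path \<Rightarrow> 'a set" where
  "occurring (FinPath s ts) = act ` set ts"
| "occurring (InfPath s us) = act ` sset us"

fun chain :: "('s, 'a) lts \<Rightarrow> 's \<Rightarrow> ('s, 'a) trans list \<Rightarrow> bool" where
  "chain M s [] \<longleftrightarrow> s \<in> states M"
| "chain M s (t # ts) \<longleftrightarrow> t \<in> transs M \<and> src t = s \<and> chain M (tgt t) ts"

primrec is_path :: "('s, 'a) lts \<Rightarrow> ('s, 'a) path \<Rightarrow> bool" where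
  "is_path M (FinPath s ts) \<longleftrightarrow> chain M s ts"
| "is_path M (InfPath s us) \<longleftrightarrow> src (us !! 0) = s \<and>
     (\<forall>i. us !! i \<in> transs M \<and> src (us !! Suc i) = tgt (us !! i))"

definition free :: "'a set \<Rightarrow> ('s, 'a) path \<Rightarrow> bool" where
  "free \<alpha> \<pi> \<longleftrightarrow> occurring \<pi> \<inter> \<alpha> = {}"

text \<open>The prefix of a path before its first transition with an action in \<open>\<alpha>\<close>.
  For infinite paths, this is only meaningful if such a transition exists.\<close>

fun before_first :: "'a set \<Rightarrow> ('s, 'a) path \<Rightarrow> ('s, 'a) path" where
  "before_first \<alpha> (FinPath s ts) = FinPath s (takeWhile (\<lambda>t. act t \<notin> \<alpha>) ts)"
| "before_first \<alpha> (InfPath s us) = FinPath s (stake (LEAST n. act (us !! n) \<in> \<alpha>) us)"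

text \<open>Only meaningful if the first path is finite and ends in the first state of the second.\<close>

fun path_append :: "('s, 'a) path \<Rightarrow> ('s, 'a) path \<Rightarrow> ('s, 'a) path" where
  "path_append (FinPath s ts) (FinPath s' us) = FinPath s (ts @ us)"
| "path_append (FinPath s ts) (InfPath s' us) = InfPath s (ts @- us)"
| "path_append (InfPath s ts) \<pi> = undefined"

definition progressing :: "('s, 'a) lts \<Rightarrow> 'a set \<Rightarrow> ('s, 'a) path \<Rightarrow> bool" where
  "progressing M B \<pi> \<longleftrightarrow> (finite_path \<pi> \<longrightarrow> locked M B (final \<pi>))"

datatype 'a reg =
  Eps
| Acts "'a set"
| Seq "'a reg" "'a reg"
| Alt "'a reg" "'a reg"
| Star "'a reg"

primrec reg_over :: "'a set \<Rightarrow> 'a reg \<Rightarrow> bool" where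
  "reg_over A Eps = True"
| "reg_over A (Acts \<alpha>) = (\<alpha> \<subseteq> A)"
| "reg_over A (Seq R Q) = (reg_over A R \<and> reg_over A Q)"
| "reg_over A (Alt R Q) = (reg_over A R \<and> reg_over A Q)"
| "reg_over A (Star R) = reg_over A R"

primrec lang :: "'a reg \<Rightarrow> 'a list set" where
  "lang Eps = {[]}"
| "lang (Acts \<alpha>) = {[a] | a. a \<in> \<alpha>}"
| "lang (Seq R Q) = {u @ v | u v. u \<in> lang R \<and> v \<in> lang Q}"
| "lang (Alt R Q) = lang R \<union> lang Q"
| "lang (Star R) = {concat ws | ws. ws \<in> lists (lang R)}"

definition matches :: "('s, 'a) path \<Rightarrow> 'a reg \<Rightarrow> bool" where
  "matches \<pi> R \<longleftrightarrow> finite_path \<pi> \<and> word \<pi> \<in> lang R"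

definition violating ::
  "('s, 'a) lts \<Rightarrow> 'a reg \<Rightarrow> 'a set \<Rightarrow> 'a set \<Rightarrow> ('s, 'a) path \<Rightarrow> bool" where
  "violating M \<rho> \<alpha>\<^sub>f \<alpha>\<^sub>e \<pi> \<longleftrightarrow>
     (\<exists>\<pi>\<^sub>p \<pi>\<^sub>s. is_path M \<pi>\<^sub>p \<and> is_path M \<pi>\<^sub>s \<and> finite_path \<pi>\<^sub>p \<and> final \<pi>\<^sub>p = first \<pi>\<^sub>s \<and>
        \<pi> = path_append \<pi>\<^sub>p \<pi>\<^sub>s \<and> matches \<pi>\<^sub>p \<rho> \<and>
        (free \<alpha>\<^sub>f \<pi>\<^sub>s \<or> occurring \<pi>\<^sub>s \<inter> \<alpha>\<^sub>e \<noteq> {} \<and> free \<alpha>\<^sub>f (before_first \<alpha>\<^sub>e \<pi>\<^sub>s)))"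

type_synonym var = nat

datatype 'a form =
  FF
| Var var
| Neg "'a form"
| Or "'a form" "'a form"
| Dia 'a "'a form"
| Mu var "'a form"

text \<open>\<^term>\<open>lfp\<close> is taken in the lattice of all sets of type \<open>'s set\<close>. If the environment
  only has values within \<^term>\<open>states M\<close>, then for syntactically monotone formulae
  this is also the least fixpoint among the subsets of \<^term>\<open>states M\<close>.\<close>

primrec sem :: "('s, 'a) lts \<Rightarrow> 'a form \<Rightarrow> (var \<Rightarrow> 's set) \<Rightarrow> 's set" where
  "sem M FF e = {}"
| "sem M (Var x) e = e x"
| "sem M (Neg \<phi>) e = states M - sem M \<phi> e"
| "sem M (Or \<phi> \<psi>) e = sem M \<phi> e \<union> sem M \<psi> e"
| "sem M (Dia a \<phi>) e = {s \<in> states M. \<exists>s'. (s, a, s') \<in> transs M \<and> s' \<in> sem M \<phi> e}"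
| "sem M (Mu x \<phi>) e = lfp (\<lambda>T. sem M \<phi> (e(x := T)))"

text \<open>\<open>occ True x \<phi>\<close> (\<open>occ False x \<phi>\<close>): every free occurrence of \<open>x\<close> in \<open>\<phi>\<close> is below an
  even (odd) number of negations.\<close>

primrec occ :: "bool \<Rightarrow> var \<Rightarrow> 'a form \<Rightarrow> bool" where
  "occ b x FF = True"
| "occ b x (Var y) = (x = y \<longrightarrow> b)"
| "occ b x (Neg \<phi>) = occ (\<not> b) x \<phi>"
| "occ b x (Or \<phi> \<psi>) = (occ b x \<phi> \<and> occ b x \<psi>)"
| "occ b x (Dia a \<phi>) = occ b x \<phi>"
| "occ b x (Mu y \<phi>) = (x = y \<or> occ b x \<phi>)"

primrec syn_mono :: "'a form \<Rightarrow> bool" where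
  "syn_mono FF = True"
| "syn_mono (Var y) = True"
| "syn_mono (Neg \<phi>) = syn_mono \<phi>"
| "syn_mono (Or \<phi> \<psi>) = (syn_mono \<phi> \<and> syn_mono \<psi>)"
| "syn_mono (Dia a \<phi>) = syn_mono \<phi>"
| "syn_mono (Mu y \<phi>) = (occ True y \<phi> \<and> syn_mono \<phi>)"

abbreviation TT :: "'a form" where "TT \<equiv> Neg FF"

text \<open>Substitution for the free occurrences of \<open>x\<close>. It does not rename bound variables; in
  \<open>Nu\<close> below the substituted formula has no free variable but \<open>x\<close>, so nothing is captured.\<close>

primrec subst :: "var \<Rightarrow> 'a form \<Rightarrow> 'a form \<Rightarrow> 'a form" where
  "subst x \<psi> FF = FF"
| "subst x \<psi> (Var y) = (if x = y then \<psi> else Var y)"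
| "subst x \<psi> (Neg \<phi>) = Neg (subst x \<psi> \<phi>)"
| "subst x \<psi> (Or \<phi>\<^sub>1 \<phi>\<^sub>2) = Or (subst x \<psi> \<phi>\<^sub>1) (subst x \<psi> \<phi>\<^sub>2)"
| "subst x \<psi> (Dia a \<phi>) = Dia a (subst x \<psi> \<phi>)"
| "subst x \<psi> (Mu y \<phi>) = (if x = y then Mu y \<phi> else Mu y (subst x \<psi> \<phi>))"

definition Nu :: "var \<Rightarrow> 'a form \<Rightarrow> 'a form" where
  "Nu x \<phi> = Neg (Mu x (Neg (subst x (Neg (Var x)) \<phi>)))"

primrec vars :: "'a form \<Rightarrow> var set" where
  "vars FF = {}"
| "vars (Var y) = {y}"
| "vars (Neg \<phi>) = vars \<phi>"
| "vars (Or \<phi> \<psi>) = vars \<phi> \<union> vars \<psi>"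
| "vars (Dia a \<phi>) = vars \<phi>"
| "vars (Mu y \<phi>) = insert y (vars \<phi>)"

definition fresh :: "'a form \<Rightarrow> var" where
  "fresh \<phi> = (LEAST y. y \<notin> vars \<phi>)"

text \<open>The finite disjunction of the formulae \<open>f a\<close> for \<open>a \<in> \<alpha>\<close>, in some fixed order of \<open>\<alpha>\<close>;
  only meaningful if \<open>\<alpha>\<close> is finite.\<close>

definition BigOr :: "'a set \<Rightarrow> ('a \<Rightarrow> 'a form) \<Rightarrow> 'a form" where
  "BigOr \<alpha> f = foldr (\<lambda>a. Or (f a)) (SOME as. set as = \<alpha> \<and> distinct as) FF"

primrec DiaR :: "'a reg \<Rightarrow> 'a form \<Rightarrow> 'a form" where
  "DiaR Eps \<phi> = \<phi>"
| "DiaR (Acts \<alpha>) \<phi> = BigOr \<alpha> (\<lambda>a. Dia a \<phi>)"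
| "DiaR (Seq R Q) \<phi> = DiaR R (DiaR Q \<phi>)"
| "DiaR (Alt R Q) \<phi> = Or (DiaR R \<phi>) (DiaR Q \<phi>)"
| "DiaR (Star R) \<phi> = Mu (fresh \<phi>) (Or (DiaR R (Var (fresh \<phi>))) \<phi>)"

definition BoxR :: "'a reg \<Rightarrow> 'a form \<Rightarrow> 'a form" where
  "BoxR R \<phi> = Neg (DiaR R (Neg \<phi>))"

lemma finite_vars: "finite (vars \<phi>)"
  by (induction \<phi>) auto

lemma fresh_notin_vars: "fresh \<phi> \<notin> vars \<phi>"
  unfolding fresh_def by (rule LeastI_ex) (rule ex_new_if_finite[OF infinite_UNIV_nat finite_vars])

lemma occ_not_in_vars: "x \<notin> vars \<phi> \<Longrightarrow> occ b x \<phi>"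
  by (induction \<phi> arbitrary: b) auto

lemma occ_foldr_Or: "(\<And>a. occ b x (f a)) \<Longrightarrow> occ b x (foldr (\<lambda>a. Or (f a)) as FF)"
  by (induction as) auto

lemma syn_mono_foldr_Or: "(\<And>a. syn_mono (f a)) \<Longrightarrow> syn_mono (foldr (\<lambda>a. Or (f a)) as FF)"
  by (induction as) auto

lemma occ_DiaR: "occ b x \<phi> \<Longrightarrow> occ b x (DiaR R \<phi>)"
proof (induction R arbitrary: \<phi>)
  case (Star R)
  then have "x \<noteq> fresh \<phi> \<Longrightarrow> occ b x (DiaR R (Var (fresh \<phi>)))"
    by simp
  with Star.prems show ?case
    by auto
qed (auto simp: BigOr_def intro!: occ_foldr_Or)

lemma syn_mono_DiaR: "syn_mono \<phi> \<Longrightarrow> syn_mono (DiaR R \<phi>)"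
  by (induction R arbitrary: \<phi>)
    (auto simp: BigOr_def occ_DiaR occ_not_in_vars[OF fresh_notin_vars] intro!: syn_mono_foldr_Or)

lemma syn_mono_BoxR: "syn_mono \<phi> \<Longrightarrow> syn_mono (BoxR R \<phi>)"
  by (simp add: BoxR_def syn_mono_DiaR)

lemma occ_subst_Neg: "occ b y (subst x (Neg (Var x)) \<phi>) = occ (if x = y then \<not> b else b) y \<phi>"
  by (induction \<phi> arbitrary: b) auto

lemma syn_mono_Nu: "syn_mono \<phi> \<Longrightarrow> occ True x \<phi> \<Longrightarrow> syn_mono (Nu x \<phi>)"
proof -
  have "syn_mono \<phi> \<Longrightarrow> syn_mono (subst x (Neg (Var x)) \<phi>)"
    by (induction \<phi>) (auto simp: occ_subst_Neg)
  then show "syn_mono \<phi> \<Longrightarrow> occ True x \<phi> \<Longrightarrow> syn_mono (Nu x \<phi>)"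
    by (simp add: Nu_def occ_subst_Neg)
qed

lemma syn_mono_violation_formula:
  "syn_mono (Neg (DiaR \<rho> (Nu X
     (Or (DiaR (Acts \<alpha>\<^sub>e) TT)
       (Or (BoxR (Acts \<beta>) FF)
         (DiaR (Acts \<alpha>\<^sub>f) (Var X)))))))"
  by (auto simp del: DiaR.simps simp: BoxR_def intro!: syn_mono_DiaR syn_mono_Nu occ_DiaR)

end

theory Submission
  imports Defs
begin

text \<open>
  A diamond over a regular formula is the set of states from which some word of its language leads
  into the set denoted by the body; the star case is a least fixpoint computation. The greatest
  fixpoint is the set of states that start a progressing path whose actions avoid \<open>\<alpha>\<^sub>f\<close> until an
  action in \<open>\<alpha>\<^sub>e\<close> occurs. This set is a postfixed point. Conversely, a state of the fixpoint
  without such a path has an \<open>\<alpha>\<^sub>f\<close>-free transition to another state of this kind, and iterating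
  yields an infinite \<open>\<alpha>\<^sub>f\<close>-free path, which is such a path after all.
\<close>

section \<open>Diamonds over regular formulae\<close>

text \<open>The recursion is purely relational and never intersects with \<open>states M\<close>, so
  preimages commute with unions and compose along \<open>@\<close>.\<close>

primrec pre_word :: "('s, 'a) lts \<Rightarrow> 'a list \<Rightarrow> 's set \<Rightarrow> 's set" where
  "pre_word M [] Z = Z"
| "pre_word M (a # w) Z = {s. \<exists>s'. (s, a, s') \<in> transs M \<and> s' \<in> pre_word M w Z}"

definition pre_lang :: "('s, 'a) lts \<Rightarrow> 'a list set \<Rightarrow> 's set \<Rightarrow> 's set" where
  "pre_lang M L Z = (\<Union>w\<in>L. pre_word M w Z)"

lemma pre_word_append: "pre_word M (u @ v) Z = pre_word M u (pre_word M v Z)"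
  by (induction u) auto

lemma pre_word_UN: "pre_word M w (\<Union>i\<in>I. Z i) = (\<Union>i\<in>I. pre_word M w (Z i))"
  by (induction w) auto

lemma pre_word_mono: "Z \<subseteq> Z' \<Longrightarrow> pre_word M w Z \<subseteq> pre_word M w Z'"
  by (induction w) auto

lemma pre_lang_mono: "Z \<subseteq> Z' \<Longrightarrow> pre_lang M L Z \<subseteq> pre_lang M L Z'"
  unfolding pre_lang_def by (intro UN_mono order_refl pre_word_mono)

text \<open>Existential preimages commute with unions, so the union over \<open>lang Q\<close> can
  be pulled out of the preimage under each word of \<open>lang R\<close>.\<close>

lemma pre_lang_Seq: "pre_lang M (lang (Seq R Q)) Z = pre_lang M (lang R) (pre_lang M (lang Q) Z)"
proof -
  have "lang (Seq R Q) = (\<Union>u\<in>lang R. (@) u ` lang Q)"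
    by auto
  then show ?thesis
    by (simp add: pre_lang_def pre_word_UN pre_word_append)
qed

lemma trans_closed:
  "finite_lts M \<Longrightarrow> t \<in> transs M \<Longrightarrow> src t \<in> states M \<and> act t \<in> acts M \<and> tgt t \<in> states M"
  by (cases t) (auto simp: finite_lts_def)

lemma mem_pre_word_Cons:
  "s \<in> pre_word M (a # w) Z \<longleftrightarrow>
    (\<exists>t\<in>transs M. src t = s \<and> act t = a \<and> tgt t \<in> pre_word M w Z)"
  by force

lemma pre_lang_Acts:
  "pre_lang M (lang (Acts \<alpha>)) Z = {s. \<exists>t\<in>transs M. src t = s \<and> act t \<in> \<alpha> \<and> tgt t \<in> Z}"
proof -
  have "lang (Acts \<alpha>) = (\<lambda>a. [a]) ` \<alpha>"
    by auto
  then show ?thesis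
    unfolding pre_lang_def by (simp add: set_eq_iff mem_pre_word_Cons del: pre_word.simps(2)) blast
qed

text \<open>A word \<open>concat ws\<close> is absorbed by unfolding the fixpoint once per factor.
  Conversely, the left side is a prefixed point: the empty list contributes \<open>Z\<close>, and
  one more factor in front of a list of factors gives such a list again.\<close>

lemma pre_lang_Star:
  "pre_lang M (lang (Star R)) Z = lfp (\<lambda>T. pre_lang M (lang R) T \<union> Z)" (is "?P = lfp ?F")
proof
  have mono: "mono ?F"
    using pre_lang_mono by (intro monoI) blast
  have "pre_word M (concat ws) Z \<subseteq> lfp ?F" if "ws \<in> lists (lang R)" for ws
    using that
  proof (induction ws)
    case Nil
    then show ?case
      by (subst lfp_unfold[OF mono]) simp
  next
    case (Cons w ws)
    then have "pre_word M (concat (w # ws)) Z \<subseteq> pre_lang M (lang R) (lfp ?F)"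
      using pre_word_mono[of "pre_word M (concat ws) Z" "lfp ?F" M w]
      by (auto simp: pre_lang_def pre_word_append)
    then show ?case
      by (subst lfp_unfold[OF mono]) blast
  qed
  then show "?P \<subseteq> lfp ?F"
    by (auto simp: pre_lang_def)
  have "pre_word M w ?P \<subseteq> ?P" if "w \<in> lang R" for w
  proof
    fix s assume "s \<in> pre_word M w ?P"
    then obtain ws where "ws \<in> lists (lang R)" "s \<in> pre_word M (concat (w # ws)) Z"
      by (auto simp: pre_lang_def pre_word_UN pre_word_append)
    with that show "s \<in> ?P"
      unfolding pre_lang_def lang.simps by (intro UN_I CollectI exI[of _ "w # ws"]) simp_all
  qed
  moreover have "Z \<subseteq> ?P"
    by (auto simp: pre_lang_def intro!: exI[of _ "[]"])
  ultimately show "lfp ?F \<subseteq> ?P"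
    by (intro lfp_lowerbound) (auto simp: pre_lang_def)
qed

text \<open>Finiteness makes the \<open>SOME\<close> list exist; the union depends only on its set
  of elements, not on the chosen order.\<close>

lemma sem_BigOr:
  assumes "finite \<alpha>"
  shows "sem M (BigOr \<alpha> f) e = (\<Union>a\<in>\<alpha>. sem M (f a) e)"
proof -
  have "sem M (foldr (\<lambda>a. Or (f a)) as FF) e = (\<Union>a\<in>set as. sem M (f a) e)" for as
    by (induction as) auto
  moreover have "set (SOME as. set as = \<alpha> \<and> distinct as) = \<alpha>"
    using someI_ex[OF finite_distinct_list[OF assms]] by simp
  ultimately show ?thesis
    by (simp add: BigOr_def)
qed

text \<open>Needed for the star: reassigning the fresh fixpoint variable must not change the meaning
  of the body.\<close>

lemma sem_cong_vars: "(\<And>x. x \<in> vars \<phi> \<Longrightarrow> e x = e' x) \<Longrightarrow> sem M \<phi> e = sem M \<phi> e'"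
proof (induction \<phi> arbitrary: e e')
  case (Mu y \<phi>)
  then have "sem M \<phi> (e(y := T)) = sem M \<phi> (e'(y := T))" for T
    by (intro Mu.IH) auto
  then show ?case
    by simp
next
  case (Or \<phi> \<psi>)
  then show ?case
    by (metis UnCI sem.simps(4) vars.simps(4))
next
  case (Neg \<phi>)
  then show ?case
    by (metis sem.simps(3) vars.simps(3))
next
  case (Dia a \<phi>)
  then have "sem M \<phi> e = sem M \<phi> e'"
    by (metis vars.simps(5))
  then show ?case
    by simp
qed auto

text \<open>\<open>\<phi>\<close> and \<open>e\<close> are generalised in the induction, since a
  sequence nests diamonds and a star updates the environment. \<open>reg_over\<close> bounds each
  action set by the finite \<open>acts M\<close>, as \<open>BigOr\<close> requires.\<close>

lemma sem_DiaR:
  assumes "finite_lts M" "reg_over (acts M) R"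
  shows "sem M (DiaR R \<phi>) e = pre_lang M (lang R) (sem M \<phi> e)"
  using assms(2)
proof (induction R arbitrary: \<phi> e)
  case Eps
  then show ?case
    by (simp add: pre_lang_def)
next
  case (Acts \<alpha>)
  then have "finite \<alpha>"
    using assms(1) finite_subset by (auto simp: finite_lts_def)
  then have "sem M (DiaR (Acts \<alpha>) \<phi>) e =
      {s. \<exists>t\<in>transs M. src t = s \<and> act t \<in> \<alpha> \<and> tgt t \<in> sem M \<phi> e}"
    using assms(1) by (force simp: sem_BigOr finite_lts_def)
  then show ?case
    by (simp only: pre_lang_Acts)
next
  case (Seq R Q)
  then show ?case
    by (simp del: lang.simps add: pre_lang_Seq)
next
  case (Alt R Q)
  then show ?case
    by (simp add: pre_lang_def)
next
  case (Star R)
  \<comment> \<open>The disjunct \<open>\<phi>\<close> is thus constant in the fixpoint variable and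
    plays the part of \<open>Z\<close> in \<open>pre_lang_Star\<close>.\<close>
  have "sem M \<phi> (e(fresh \<phi> := T)) = sem M \<phi> e" for T
    using fresh_notin_vars[of \<phi>] by (intro sem_cong_vars) auto
  with Star show ?case
    by (simp del: lang.simps add: pre_lang_Star)
qed

section \<open>The greatest fixpoint\<close>

text \<open>No capture can occur under a binder \<open>y\<close> other than \<open>x\<close>,
  because the substituted formula mentions only \<open>x\<close>; the updates at \<open>x\<close>
  and \<open>y\<close> then commute. A binder of \<open>x\<close> itself overwrites the outer
  update.\<close>

lemma sem_subst_Neg:
  "sem M (subst x (Neg (Var x)) \<phi>) e = sem M \<phi> (e(x := states M - e x))"
proof (induction \<phi> arbitrary: e)
  case (Mu y \<phi>)
  show ?case
  proof (cases "x = y")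
    case False
    then have "sem M (subst x (Neg (Var x)) \<phi>) (e(y := T)) =
        sem M \<phi> (e(x := states M - e x, y := T))" for T
      unfolding Mu.IH fun_upd_twist[OF False] by simp
    with False show ?thesis
      by (simp only: subst.simps sem.simps if_False)
  next
    case True
    then show ?thesis
      by (simp only: subst.simps sem.simps fun_upd_upd simp_thms if_True)
  qed
qed auto

lemma sem_Nu:
  "sem M (Nu x \<phi>) e =
     states M - lfp (\<lambda>T. states M - sem M \<phi> (e(x := states M - T)))"
  by (simp add: Nu_def sem_subst_Neg)

text \<open>De Morgan duality of fixpoints, relative to \<open>S\<close> because negation in
  \<open>sem\<close> is the complement within \<open>states M\<close>, whereas \<open>gfp\<close>
  lives in the lattice of all sets. The bound on \<open>F\<close> reconciles the two.\<close>

lemma complement_lfp_complement: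
  fixes F :: "'s set \<Rightarrow> 's set"
  assumes "mono F" "\<And>T. F T \<subseteq> S"
  shows "S - lfp (\<lambda>T. S - F (S - T)) = gfp F"
proof
  let ?G = "\<lambda>T. S - F (S - T)"
  have "mono ?G"
    by (intro monoI Diff_mono monoD[OF assms(1)]) auto
  then have "lfp ?G = S - F (S - lfp ?G)"
    by (rule lfp_unfold)
  \<comment> \<open>Complementing the unfolded equation makes \<open>S - lfp ?G\<close> a fixed
    point of \<open>F\<close>.\<close>
  with assms(2)[of "S - lfp ?G"] show "S - lfp ?G \<subseteq> gfp F"
    by (intro gfp_upperbound) auto
  have sub: "gfp F \<subseteq> S"
    using assms(2)[of "gfp F"] gfp_unfold[OF assms(1)] by simp
  then have "S - (S - gfp F) = gfp F"
    by blast
  \<comment> \<open>Dually, \<open>S - gfp F\<close> is a fixed point of \<open>?G\<close>.\<close>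
  then have "lfp ?G \<subseteq> S - gfp F"
    using gfp_unfold[OF assms(1)] by (intro lfp_lowerbound) auto
  with sub show "gfp F \<subseteq> S - lfp ?G"
    by blast
qed

text \<open>The operator denoted by the body of the greatest fixpoint, with the modalities spelled
  out on transitions.\<close>

definition escape_step ::
  "('s, 'a) lts \<Rightarrow> 'a set \<Rightarrow> 'a set \<Rightarrow> 'a set \<Rightarrow> 's set \<Rightarrow> 's set" where
  "escape_step M B \<alpha>\<^sub>f \<alpha>\<^sub>e T = {s \<in> states M. locked M B s \<or>
     (\<exists>t \<in> transs M. src t = s \<and> (act t \<in> \<alpha>\<^sub>e \<or> act t \<notin> \<alpha>\<^sub>f \<and> tgt t \<in> T))}"

lemma mono_escape_step: "mono (escape_step M B \<alpha>\<^sub>f \<alpha>\<^sub>e)"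
  by (rule monoI) (auto simp: escape_step_def)

lemma sem_escape_step:
  assumes "finite_lts M" "\<alpha>\<^sub>e \<subseteq> acts M"
  shows "sem M (Or (DiaR (Acts \<alpha>\<^sub>e) TT)
            (Or (BoxR (Acts (acts M - B)) FF)
              (DiaR (Acts (acts M - \<alpha>\<^sub>f)) (Var x)))) (e(x := T)) =
         escape_step M B \<alpha>\<^sub>f \<alpha>\<^sub>e T" (is "?L = ?R")
proof -
  have "?L = pre_lang M (lang (Acts \<alpha>\<^sub>e)) (states M) \<union>
      (states M - pre_lang M (lang (Acts (acts M - B))) (states M) \<union>
       pre_lang M (lang (Acts (acts M - \<alpha>\<^sub>f))) T)"
    using assms by (simp add: BoxR_def sem_DiaR del: DiaR.simps lang.simps)
  also have "\<dots> = ?R"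
    \<comment> \<open>All labels lie in \<open>acts M\<close>, so membership in a relative
      complement amounts to non-membership; all targets are states, so the box forbids every enabled
      action outside \<open>B\<close>.\<close>
    unfolding pre_lang_Acts escape_step_def locked_def enabled_def using trans_closed[OF assms(1)] by blast
  finally show ?thesis .
qed

section \<open>Paths\<close>

definition path_cons :: "('s, 'a) trans \<Rightarrow> ('s, 'a) path \<Rightarrow> ('s, 'a) path" where
  "path_cons t \<pi> = path_append (FinPath (src t) [t]) \<pi>"

lemma path_cons_simps [simp]:
  "path_cons t (FinPath s ts) = FinPath (src t) (t # ts)"
  "path_cons t (InfPath s us) = InfPath (src t) (t ## us)"
  by (simp_all add: path_cons_def)

lemma first_path_cons [simp]: "first (path_cons t \<pi>) = src t"
  by (cases \<pi>) simp_all

lemma is_path_path_cons: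
  "is_path M (path_cons t \<pi>)" if "t \<in> transs M" "is_path M \<pi>" "first \<pi> = tgt t"
proof (cases \<pi>)
  case (InfPath s us)
  have "(t ## us) !! i \<in> transs M \<and> src ((t ## us) !! Suc i) = tgt ((t ## us) !! i)" for i
    using that InfPath by (cases i) auto
  with InfPath show ?thesis
    by simp
qed (use that in simp)

text \<open>The hypothesis matters for a path without transitions: the extended path ends in
  \<open>tgt t\<close>, which must be its only state.\<close>

lemma progressing_path_cons:
  "first \<pi> = tgt t \<Longrightarrow> progressing M B (path_cons t \<pi>) \<longleftrightarrow> progressing M B \<pi>"
  by (cases \<pi>) (auto simp: progressing_def)

text \<open>Treats finite and infinite paths alike: an infinite path always falls under
  \<open>cons\<close>, with an infinite tail.\<close>

lemma path_cases [consumes 2, case_names trivial cons]: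
  assumes "finite_lts M" "is_path M \<pi>"
  obtains s where "\<pi> = FinPath s []" "s \<in> states M"
  | t \<pi>' where "\<pi> = path_cons t \<pi>'" "t \<in> transs M" "is_path M \<pi>'" "first \<pi>' = tgt t"
proof (cases \<pi>)
  case (FinPath s ts)
  show ?thesis
  proof (cases ts)
    case Nil
    with FinPath assms(2) that(1) show ?thesis
      by simp
  next
    case (Cons t ts')
    with FinPath assms(2) that(2)[of t "FinPath (tgt t) ts'"] show ?thesis
      by simp
  qed
next
  case (InfPath s us)
  have us: "us !! i \<in> transs M" "src (us !! Suc i) = tgt (us !! i)" "src (us !! 0) = s" for i
    using InfPath assms(2) by auto
  have "is_path M (InfPath (tgt (shd us)) (stl us))"
    using us(1)[of "Suc i" for i] us(2)[of 0] us(2)[of "Suc i" for i] by simp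
  with InfPath us(1)[of 0] us(3) that(2)[of "shd us" "InfPath (tgt (shd us)) (stl us)"]
  show ?thesis
    by simp
qed

lemma first_in_states:
  assumes "finite_lts M" "is_path M \<pi>"
  shows "first \<pi> \<in> states M"
  using assms by (cases rule: path_cases) (simp_all add: trans_closed[OF assms(1)])

lemma path_append_Cons:
  "path_append (FinPath (src t) (t # ts)) \<pi> = path_cons t (path_append (FinPath (tgt t) ts) \<pi>)"
  by (cases \<pi>) simp_all

lemma path_append_Nil: "path_append (FinPath (first \<pi>) []) \<pi> = \<pi>"
  by (cases \<pi>) simp_all

lemma first_path_append [simp]: "first (path_append (FinPath s ts) \<pi>) = s"
  by (cases \<pi>) simp_all

text \<open>Prepending a finite path is iterated \<open>path_cons\<close>; progress depends only on
  how a path ends.\<close>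

lemma path_append_is_path:
  assumes "chain M s ts" "is_path M \<pi>" "final (FinPath s ts) = first \<pi>"
  shows "is_path M (path_append (FinPath s ts) \<pi>) \<and>
    (progressing M B (path_append (FinPath s ts) \<pi>) \<longleftrightarrow> progressing M B \<pi>)"
  using assms
proof (induction ts arbitrary: s)
  case Nil
  then show ?case
    by (simp add: path_append_Nil)
next
  case (Cons t ts)
  then have "chain M (tgt t) ts" "final (FinPath (tgt t) ts) = first \<pi>"
    by (auto split: if_splits)
  from Cons.IH[OF this(1) Cons.prems(2) this(2)] Cons.prems(1) show ?case
    by (auto simp: path_append_Cons progressing_path_cons intro!: is_path_path_cons)
qed

text \<open>Links relational preimages to finite paths. For the empty word, \<open>chain\<close>
  demands that \<open>s\<close> be a state, which the bound on \<open>Z\<close> supplies.\<close>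

lemma mem_pre_word_iff:
  assumes "Z \<subseteq> states M"
  shows "s \<in> pre_word M w Z \<longleftrightarrow>
    (\<exists>ts. chain M s ts \<and> map act ts = w \<and> final (FinPath s ts) \<in> Z)"
proof (induction w arbitrary: s)
  case Nil
  then show ?case
    using assms by auto
next
  case (Cons a w)
  show ?case
  proof
    assume "s \<in> pre_word M (a # w) Z"
    then obtain t where t: "t \<in> transs M" "src t = s" "act t = a" "tgt t \<in> pre_word M w Z"
      unfolding mem_pre_word_Cons by blast
    with Cons.IH obtain ts where "chain M (tgt t) ts" "map act ts = w"
        "final (FinPath (tgt t) ts) \<in> Z"
      by blast
    with t show "\<exists>ts. chain M s ts \<and> map act ts = a # w \<and> final (FinPath s ts) \<in> Z"
      by (intro exI[of _ "t # ts"]) (simp split: if_splits)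
  next
    assume "\<exists>ts. chain M s ts \<and> map act ts = a # w \<and> final (FinPath s ts) \<in> Z"
    then obtain t ts where t: "t \<in> transs M" "src t = s" "act t = a" and
        ts: "chain M (tgt t) ts" "map act ts = w" "final (FinPath s (t # ts)) \<in> Z"
      by (auto simp: map_eq_Cons_conv simp del: final.simps)
    from ts(3) have "final (FinPath (tgt t) ts) \<in> Z"
      by (simp split: if_splits)
    with ts(1,2) have "tgt t \<in> pre_word M w Z"
      unfolding Cons.IH by blast
    with t show "s \<in> pre_word M (a # w) Z"
      unfolding mem_pre_word_Cons by blast
  qed
qed

text \<open>Choosing one transition in \<open>A\<close> per element of \<open>D\<close> gives a
  successor function on \<open>D\<close>, whose iteration never leaves \<open>D\<close>.\<close>

lemma infinite_path_if_invariant: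
  assumes "s \<in> D" "\<And>p. p \<in> D \<Longrightarrow> \<exists>t\<in>A. src t = p \<and> tgt t \<in> D" "A \<subseteq> transs M"
  shows "\<exists>us. is_path M (InfPath s us) \<and> sset us \<subseteq> A"
proof -
  obtain f where f: "\<And>p. p \<in> D \<Longrightarrow> f p \<in> A \<and> src (f p) = p \<and> tgt (f p) \<in> D"
    using assms(2) by metis
  \<comment> \<open>The iterates of \<open>tgt \<circ> f\<close> are the visited states;
    \<open>f\<close> maps each to the transition chosen there.\<close>
  define us where "us = smap f (siterate (tgt \<circ> f) s)"
  have D: "((tgt \<circ> f) ^^ i) s \<in> D" for i
    by (induction i) (auto simp: assms(1) f)
  have us: "us !! i = f (((tgt \<circ> f) ^^ i) s)" for i
    by (simp add: us_def del: comp_apply)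
  have "is_path M (InfPath s us)"
    using f D assms(1,3) by (auto simp: us simp del: snth.simps)
  moreover have "sset us \<subseteq> A"
    using f D by (auto simp: sset_range us)
  ultimately show ?thesis
    by blast
qed

text \<open>A state without a progressing path is not locked, as its trivial path would do, and its
  successors have no such path either. Following them forever yields an infinite path, which is
  progressing by definition.\<close>

lemma progressing_path_exists:
  assumes "finite_lts M" "s \<in> states M"
  shows "\<exists>\<pi>. is_path M \<pi> \<and> first \<pi> = s \<and> progressing M B \<pi>"
proof (rule ccontr)
  define D where
    "D = {p \<in> states M. \<nexists>\<pi>. is_path M \<pi> \<and> first \<pi> = p \<and> progressing M B \<pi>}"
  assume contra: "\<not> ?thesis"
  have "\<exists>t\<in>transs M. src t = p \<and> tgt t \<in> D" if "p \<in> D" for p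
  proof -
    have "\<not> locked M B p"
      using that by (auto simp: D_def progressing_def dest!: spec[of _ "FinPath p []"])
    then obtain t where t: "t \<in> transs M" "src t = p"
      by (auto simp: locked_def enabled_def)
    moreover have "tgt t \<in> states M"
      using trans_closed[OF assms(1) t(1)] by simp
    moreover have "\<nexists>\<pi>. is_path M \<pi> \<and> first \<pi> = tgt t \<and> progressing M B \<pi>"
      using that t is_path_path_cons progressing_path_cons first_path_cons
      unfolding D_def by fast
    ultimately show ?thesis
      by (auto simp: D_def)
  qed
  moreover have "s \<in> D"
    using contra assms(2) by (simp add: D_def)
  ultimately obtain us where "is_path M (InfPath s us)"
    using infinite_path_if_invariant[of s D "transs M" M] by blast
  with contra show False
    by (auto simp: progressing_def simp del: is_path.simps dest!: spec[of _ "InfPath s us"])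
qed

section \<open>Escaping paths\<close>

definition avoids_until :: "'a set \<Rightarrow> 'a set \<Rightarrow> ('s, 'a) path \<Rightarrow> bool" where
  "avoids_until \<alpha>\<^sub>f \<alpha>\<^sub>e \<pi> \<longleftrightarrow>
     free \<alpha>\<^sub>f \<pi> \<or> occurring \<pi> \<inter> \<alpha>\<^sub>e \<noteq> {} \<and> free \<alpha>\<^sub>f (before_first \<alpha>\<^sub>e \<pi>)"

text \<open>If \<open>act t\<close> is in \<open>\<alpha>\<^sub>e\<close>, the prefix before the
  first occurrence is empty, so \<open>\<alpha>\<^sub>f\<close> imposes nothing, even on
  \<open>t\<close> itself. Otherwise \<open>t\<close> joins that prefix.\<close>

lemma avoids_until_path_cons:
  "avoids_until \<alpha>\<^sub>f \<alpha>\<^sub>e (path_cons t \<pi>) \<longleftrightarrow>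
     act t \<in> \<alpha>\<^sub>e \<or> act t \<notin> \<alpha>\<^sub>f \<and> avoids_until \<alpha>\<^sub>f \<alpha>\<^sub>e \<pi>"
proof (cases \<pi>)
  case (FinPath s ts)
  then show ?thesis
    by (auto simp: avoids_until_def free_def)
next
  case (InfPath s us)
  show ?thesis
  proof (cases "act t \<in> \<alpha>\<^sub>e")
    case True
    then have "(LEAST n. act ((t ## us) !! n) \<in> \<alpha>\<^sub>e) = 0"
      by (intro Least_equality) auto
    with True InfPath show ?thesis
      by (auto simp: avoids_until_def free_def)
  next
    case False
    \<comment> \<open>The first occurrence moves by one position. This needs an occurrence to exist,
      since otherwise \<open>LEAST\<close> is unspecified; hence the final case split.\<close>
    have "(LEAST n. act ((t ## us) !! n) \<in> \<alpha>\<^sub>e) = Suc (LEAST n. act (us !! n) \<in> \<alpha>\<^sub>e)"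
      if "act ` sset us \<inter> \<alpha>\<^sub>e \<noteq> {}"
    proof -
      from that obtain n where "act ((t ## us) !! Suc n) \<in> \<alpha>\<^sub>e"
        by (auto simp: sset_range)
      from Least_Suc[where P = "\<lambda>n. act ((t ## us) !! n) \<in> \<alpha>\<^sub>e", OF this] False show ?thesis
        by simp
    qed
    with False InfPath show ?thesis
      by (cases "act ` sset us \<inter> \<alpha>\<^sub>e = {}") (simp_all add: avoids_until_def free_def, blast)
  qed
qed

definition escaping :: "('s, 'a) lts \<Rightarrow> 'a set \<Rightarrow> 'a set \<Rightarrow> 'a set \<Rightarrow> 's set" where
  "escaping M B \<alpha>\<^sub>f \<alpha>\<^sub>e =
     {first \<pi> | \<pi>. is_path M \<pi> \<and> progressing M B \<pi> \<and> avoids_until \<alpha>\<^sub>f \<alpha>\<^sub>e \<pi>}"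

lemma escapingI:
  "is_path M \<pi> \<Longrightarrow> progressing M B \<pi> \<Longrightarrow> avoids_until \<alpha>\<^sub>f \<alpha>\<^sub>e \<pi> \<Longrightarrow> first \<pi> = s \<Longrightarrow>
    s \<in> escaping M B \<alpha>\<^sub>f \<alpha>\<^sub>e"
  by (auto simp: escaping_def)

lemma escaping_step_free:
  assumes "t \<in> transs M" "act t \<notin> \<alpha>\<^sub>f" "tgt t \<in> escaping M B \<alpha>\<^sub>f \<alpha>\<^sub>e"
  shows "src t \<in> escaping M B \<alpha>\<^sub>f \<alpha>\<^sub>e"
proof -
  from assms(3) obtain \<pi> where
    "is_path M \<pi>" "progressing M B \<pi>" "avoids_until \<alpha>\<^sub>f \<alpha>\<^sub>e \<pi>" "first \<pi> = tgt t"
    by (auto simp: escaping_def)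
  with assms(1,2) show ?thesis
    by (intro escapingI[of _ "path_cons t \<pi>"])
      (simp_all add: is_path_path_cons progressing_path_cons avoids_until_path_cons)
qed

text \<open>After an action in \<open>\<alpha>\<^sub>e\<close> the path only has to be progressing,
  and some progressing continuation always exists.\<close>

lemma escaping_step_end:
  assumes "finite_lts M" "t \<in> transs M" "act t \<in> \<alpha>\<^sub>e"
  shows "src t \<in> escaping M B \<alpha>\<^sub>f \<alpha>\<^sub>e"
proof -
  have "tgt t \<in> states M"
    using trans_closed[OF assms(1,2)] by simp
  then obtain \<pi> where "is_path M \<pi>" "first \<pi> = tgt t" "progressing M B \<pi>"
    using progressing_path_exists[OF assms(1)] by blast
  with assms(2,3) show ?thesis
    by (intro escapingI[of _ "path_cons t \<pi>"])
      (simp_all add: is_path_path_cons progressing_path_cons avoids_until_path_cons)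
qed

lemma escaping_eq_gfp:
  assumes "finite_lts M"
  shows "escaping M B \<alpha>\<^sub>f \<alpha>\<^sub>e = gfp (escape_step M B \<alpha>\<^sub>f \<alpha>\<^sub>e)" (is "?W = gfp ?F")
proof
  have "s \<in> ?F ?W" if "s \<in> ?W" for s
  proof -
    from that obtain \<pi> where \<pi>:
      "is_path M \<pi>" "progressing M B \<pi>" "avoids_until \<alpha>\<^sub>f \<alpha>\<^sub>e \<pi>" "first \<pi> = s"
      by (auto simp: escaping_def)
    have "s \<in> states M"
      using first_in_states[OF assms \<pi>(1)] \<pi>(4) by simp
    from assms \<pi>(1) show ?thesis
    proof (cases rule: path_cases)
      case (trivial s')
      with \<pi>(2,4) show ?thesis
        by (auto simp: escape_step_def progressing_def)
    next
      case (cons t \<pi>')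
      \<comment> \<open>Unless the first action already ends the obligation, the tail is itself a
        witness for \<open>tgt t\<close>.\<close>
      then have "act t \<notin> \<alpha>\<^sub>e \<Longrightarrow> act t \<notin> \<alpha>\<^sub>f \<and> tgt t \<in> ?W"
        using \<pi> by (auto simp: avoids_until_path_cons progressing_path_cons intro: escapingI)
      with cons \<pi>(4) \<open>s \<in> states M\<close> show ?thesis
        by (auto simp: escape_step_def)
    qed
  qed
  then show "?W \<subseteq> gfp ?F"
    by (intro gfp_upperbound) blast
next
  \<comment> \<open>\<open>D\<close> collects the supposed counterexamples and will be invariant
    under suitable transitions in \<open>A\<close>.\<close>
  define D where "D = gfp ?F - ?W"
  define A where "A = {t \<in> transs M. act t \<notin> \<alpha>\<^sub>f}"
  have step: "\<exists>t\<in>A. src t = p \<and> tgt t \<in> D" if "p \<in> D" for p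
  proof -
    have "p \<in> ?F (gfp ?F)" "p \<notin> ?W"
      using that gfp_unfold[OF mono_escape_step, of M B \<alpha>\<^sub>f \<alpha>\<^sub>e] by (auto simp: D_def)
    \<comment> \<open>At a locked state the trivial path is progressing and free of every action,
      which would put \<open>p\<close> into \<open>?W\<close>.\<close>
    moreover from this have "\<not> locked M B p"
      using escapingI[of M "FinPath p []" B \<alpha>\<^sub>f \<alpha>\<^sub>e p]
      by (auto simp: escape_step_def progressing_def avoids_until_def free_def)
    ultimately obtain t where "t \<in> transs M" "src t = p" "act t \<notin> \<alpha>\<^sub>f" "tgt t \<in> gfp ?F"
      \<comment> \<open>The alternative with an action in \<open>\<alpha>\<^sub>e\<close> would also
        put \<open>p\<close> into \<open>?W\<close>; only the third one remains.\<close>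
      using escaping_step_end[OF assms] unfolding escape_step_def by blast
    moreover from this have "tgt t \<notin> ?W"
      using escaping_step_free \<open>p \<notin> ?W\<close> by metis
    ultimately show ?thesis
      by (intro bexI[of _ t]) (simp_all add: D_def A_def)
  qed
  show "gfp ?F \<subseteq> ?W"
  proof (rule ccontr)
    assume "\<not> gfp ?F \<subseteq> ?W"
    then obtain s where "s \<in> D"
      by (auto simp: D_def)
    then obtain us where us: "is_path M (InfPath s us)" "sset us \<subseteq> A"
      using infinite_path_if_invariant[of s D A M] step by (auto simp: A_def)
    then have "s \<in> ?W"
      by (intro escapingI[of M "InfPath s us"])
        (auto simp: progressing_def avoids_until_def free_def A_def simp del: is_path.simps)
    with \<open>s \<in> D\<close> show False
      by (simp add: D_def)
  qed
qed

text \<open>A violating path is progressing exactly if its suffix is, so the suffix witnesses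
  \<open>escaping\<close> while the prefix spells the word of \<open>\<rho>\<close>.\<close>

lemma violating_path_iff:
  assumes "finite_lts M"
  shows "(\<exists>\<pi>. is_path M \<pi> \<and> first \<pi> = s \<and> progressing M B \<pi> \<and> violating M \<rho> \<alpha>\<^sub>f \<alpha>\<^sub>e \<pi>) \<longleftrightarrow>
    s \<in> pre_lang M (lang \<rho>) (escaping M B \<alpha>\<^sub>f \<alpha>\<^sub>e)" (is "?L \<longleftrightarrow> ?R")
proof -
  have sub: "escaping M B \<alpha>\<^sub>f \<alpha>\<^sub>e \<subseteq> states M"
    using first_in_states[OF assms] by (auto simp: escaping_def)
  show ?thesis
  proof
    assume ?L
    then obtain \<pi> \<pi>\<^sub>p \<pi>\<^sub>s where \<pi>: "first \<pi> = s" "progressing M B \<pi>" "\<pi> = path_append \<pi>\<^sub>p \<pi>\<^sub>s"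
        "is_path M \<pi>\<^sub>p" "is_path M \<pi>\<^sub>s" "finite_path \<pi>\<^sub>p" "final \<pi>\<^sub>p = first \<pi>\<^sub>s"
        "matches \<pi>\<^sub>p \<rho>" "avoids_until \<alpha>\<^sub>f \<alpha>\<^sub>e \<pi>\<^sub>s"
      unfolding violating_def avoids_until_def by blast
    then obtain ts where ts: "\<pi>\<^sub>p = FinPath s ts"
      by (cases \<pi>\<^sub>p) auto
    with \<pi> have "progressing M B \<pi>\<^sub>s"
      using path_append_is_path[of M s ts \<pi>\<^sub>s B] by simp
    with \<pi> have "first \<pi>\<^sub>s \<in> escaping M B \<alpha>\<^sub>f \<alpha>\<^sub>e"
      by (intro escapingI) auto
    with \<pi> ts have "s \<in> pre_word M (map act ts) (escaping M B \<alpha>\<^sub>f \<alpha>\<^sub>e)"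
      unfolding mem_pre_word_iff[OF sub] by (intro exI[of _ ts]) (simp del: final.simps)
    with \<pi> ts show ?R
      by (auto simp: pre_lang_def matches_def)
  next
    assume ?R
    then obtain ts where ts: "map act ts \<in> lang \<rho>" "chain M s ts"
        "final (FinPath s ts) \<in> escaping M B \<alpha>\<^sub>f \<alpha>\<^sub>e"
      unfolding pre_lang_def by (auto simp: mem_pre_word_iff[OF sub] simp del: final.simps)
    then obtain \<pi>\<^sub>s where \<pi>\<^sub>s: "is_path M \<pi>\<^sub>s" "progressing M B \<pi>\<^sub>s" "avoids_until \<alpha>\<^sub>f \<alpha>\<^sub>e \<pi>\<^sub>s"
        "final (FinPath s ts) = first \<pi>\<^sub>s"
      by (auto simp: escaping_def simp del: final.simps)
    let ?\<pi> = "path_append (FinPath s ts) \<pi>\<^sub>s"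
    have "violating M \<rho> \<alpha>\<^sub>f \<alpha>\<^sub>e ?\<pi>"
      unfolding violating_def using ts \<pi>\<^sub>s
      by (intro exI[of _ "FinPath s ts"] exI[of _ \<pi>\<^sub>s])
        (simp add: matches_def avoids_until_def del: final.simps)
    moreover have "is_path M ?\<pi> \<and> progressing M B ?\<pi>"
      using path_append_is_path[OF ts(2) \<pi>\<^sub>s(1,4)] \<pi>\<^sub>s(2) by blast
    ultimately show ?L
      by (intro exI[of _ ?\<pi>]) simp
  qed
qed

theorem theorem21:
  fixes M :: "('s, 'a) lts" and B \<alpha>\<^sub>f \<alpha>\<^sub>e :: "'a set" and \<rho> :: "'a reg"
    and X :: var and e :: "var \<Rightarrow> 's set" and s :: 's
  assumes "finite_lts M"
    and "B \<subseteq> acts M"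
    and "reg_over (acts M) \<rho>"
    and "\<alpha>\<^sub>f \<subseteq> acts M"
    and "\<alpha>\<^sub>e \<subseteq> acts M"
    and "\<And>x. e x \<subseteq> states M"
    and "s \<in> states M"
  shows "s \<in> sem M (Neg (DiaR \<rho> (Nu X
             (Or (DiaR (Acts \<alpha>\<^sub>e) TT)
               (Or (BoxR (Acts (acts M - B)) FF)
                 (DiaR (Acts (acts M - \<alpha>\<^sub>f)) (Var X))))))) e
    \<longleftrightarrow> \<not> (\<exists>\<pi>. is_path M \<pi> \<and> first \<pi> = s \<and> progressing M B \<pi> \<and> violating M \<rho> \<alpha>\<^sub>f \<alpha>\<^sub>e \<pi>)"
proof -
  let ?F = "escape_step M B \<alpha>\<^sub>f \<alpha>\<^sub>e"
  have "?F T \<subseteq> states M" for T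
    by (auto simp: escape_step_def)
  then have "states M - lfp (\<lambda>T. states M - ?F (states M - T)) = escaping M B \<alpha>\<^sub>f \<alpha>\<^sub>e"
    using complement_lfp_complement[OF mono_escape_step] escaping_eq_gfp[OF assms(1)] by metis
  then show ?thesis
    \<comment> \<open>Both sides now speak of the same \<open>pre_lang\<close> set; the outer
      negation is a complement in \<open>states M\<close>, which contains \<open>s\<close>.\<close>
    unfolding violating_path_iff[OF assms(1)] sem.simps(3) sem_DiaR[OF assms(1,3)] sem_Nu
      sem_escape_step[OF assms(1,5)]
    using assms(7) by simp
qed

end
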